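(* For every distribution $F$ on $[0,v_{\max}]$, there exists a mechanism that is $1$-consistent and $0.5$-robust for $F$.
   Context: Fix $v_{\max}\in(0,\infty)$. A distribution $F$ on $[0,v_{\max}]$ is a (Borel) probability distribution, with the convention $F(v)=\mathbb P[V<v]$ for $V$ distributed according to $F$. Let $\mathrm{OPT}(F)=\max_{p\ge 0} p\,(1-F(p))$ be the optimal posted-price revenue. A buyer has a value $v\in[0,v_{\max}]$; the seller privately observes a signal $s$. In the accurate state $\mathsf A$ the value $v$ is arbitrary and $s=v$; in the hallucinatory state $\mathsf H$, $v\sim F$ and $s\sim F$ are independent. The buyer knows $v$ and the state but not $s$; the seller knows $s$ and $F$ only. A mechanism (for $F$) is an allocation rule $x(s,v,\theta)\in[0,1]$ and a payment rule $p(s,v,\theta)\in\mathbb R$, with $\theta\in\{\mathsf A,\mathsf H\}$ (measurable, and such that the expectations below are well defined), where $s$ is the seller's signal and $(v,\theta)$ the buyer's report, satisfying for all $v,v'\in[0,v_{\max}]$: - (IC) $\mathbb E_{s\sim F}[v\,x(s,v,\mathsf H)-p(s,v,\mathsf H)]\ge \mathbb E_{s\sim F}[v\,x(s,v',\mathsf H)-p(s,v',\mathsf H)]$ and $v\,x(v,v,\mathsf A)-p(v,v,\mathsf A)\ge v\,x(v,v',\mathsf H)-p(v,v',\mathsf H)$; - (IR) $\mathbb E_{s\sim F}[v\,x(s,v,\mathsf H)-p(s,v,\mathsf H)]\ge 0$ and $v\,x(v,v,\mathsf A)-p(v,v,\mathsf A)\ge 0$. (No further incentive constraints are imposed; deviations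 in which the buyer falsely reports state $\mathsf A$, or reports $\mathsf A$ with a wrong value, are not constrained.) The mechanism is $C$-consistent if $p(v,v,\mathsf A)\ge C\,v$ for all $v\in[0,v_{\max}]$. It is $R$-robust (for $F$) if $\mathbb E_{s\sim F,\,v\sim F}[p(s,v,\mathsf H)]\ge R\cdot \mathrm{OPT}(F)$, with $s,v$ independent. *)

theory Defs
  imports "HOL-Probability.Probability" "HOL-Real_Asymp.Real_Asymp"
begin

definition values_space :: "real \<Rightarrow> real measure" where
  "values_space vmax = restrict_space borel {0..vmax}"

definition distribution_on :: "real \<Rightarrow> real measure \<Rightarrow> bool" where
  "distribution_on vmax F \<longleftrightarrow> prob_space F \<and> sets F = sets (values_space vmax)"

(* Left-continuous convention P[V < v]; the library's cdf is P[V \<le> v]. *)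
definition distr_fun :: "real measure \<Rightarrow> real \<Rightarrow> real" where
  "distr_fun F v = measure F {u \<in> space F. u < v}"

definition price_revenue :: "real measure \<Rightarrow> real \<Rightarrow> real" where
  "price_revenue F p = p * (1 - distr_fun F p)"

(* The supremum is a maximum: see OPT_attained and price_revenue_le_OPT. *)
definition OPT :: "real measure \<Rightarrow> real" where
  "OPT F = (SUP p\<in>{0..}. price_revenue F p)"

datatype state = Accurate | Hallucinatory

(* Arguments: the seller's signal s, the reported value v, the reported state.
   Only the restriction to s, v in [0, vmax] is meaningful. *)
type_synonym rule = "real \<Rightarrow> real \<Rightarrow> state \<Rightarrow> real"

definition incentive_compatible :: "real \<Rightarrow> real measure \<Rightarrow> rule \<Rightarrow> rule \<Rightarrow> bool" where
  "incentive_compatible vmax F x p \<longleftrightarrow>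
     (\<forall>v\<in>{0..vmax}. \<forall>v'\<in>{0..vmax}.
        (\<integral>s. v * x s v Hallucinatory - p s v Hallucinatory \<partial>F)
          \<ge> (\<integral>s. v * x s v' Hallucinatory - p s v' Hallucinatory \<partial>F) \<and>
        v * x v v Accurate - p v v Accurate
          \<ge> v * x v v' Hallucinatory - p v v' Hallucinatory)"

definition individually_rational :: "real \<Rightarrow> real measure \<Rightarrow> rule \<Rightarrow> rule \<Rightarrow> bool" where
  "individually_rational vmax F x p \<longleftrightarrow>
     (\<forall>v\<in>{0..vmax}.
        (\<integral>s. v * x s v Hallucinatory - p s v Hallucinatory \<partial>F) \<ge> 0 \<and>
        v * x v v Accurate - p v v Accurate \<ge> 0)"

(* All expectations in the development are taken in the hallucinatory state.  The allocation
   is bounded, so integrability of the payments is what makes them well defined (and finite);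
   it matters because the Bochner integral of a non-integrable function is 0. *)
definition mechanism :: "real \<Rightarrow> real measure \<Rightarrow> rule \<Rightarrow> rule \<Rightarrow> bool" where
  "mechanism vmax F x p \<longleftrightarrow>
     (\<forall>\<theta>. (\<lambda>(s, v). x s v \<theta>) \<in> borel_measurable (values_space vmax \<Otimes>\<^sub>M values_space vmax)) \<and>
     (\<forall>\<theta>. (\<lambda>(s, v). p s v \<theta>) \<in> borel_measurable (values_space vmax \<Otimes>\<^sub>M values_space vmax)) \<and>
     (\<forall>s\<in>{0..vmax}. \<forall>v\<in>{0..vmax}. \<forall>\<theta>. x s v \<theta> \<in> {0..1}) \<and>
     (\<forall>v\<in>{0..vmax}. integrable F (\<lambda>s. p s v Hallucinatory)) \<and>
     integrable (F \<Otimes>\<^sub>M F) (\<lambda>(s, v). p s v Hallucinatory) \<and>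
     incentive_compatible vmax F x p \<and>
     individually_rational vmax F x p"

definition consistent :: "real \<Rightarrow> real \<Rightarrow> rule \<Rightarrow> bool" where
  "consistent vmax C p \<longleftrightarrow> (\<forall>v\<in>{0..vmax}. p v v Accurate \<ge> C * v)"

definition robust :: "real measure \<Rightarrow> real \<Rightarrow> rule \<Rightarrow> bool" where
  "robust F R p \<longleftrightarrow> (\<integral>(s, v). p s v Hallucinatory \<partial>(F \<Otimes>\<^sub>M F)) \<ge> R * OPT F"

lemma distribution_on_simps:
  assumes "distribution_on vmax F"
  shows "prob_space F" "space F = {0..vmax}"
    "sets F = sets (restrict_space borel {0..vmax})"
proof -
  show "prob_space F" using assms by (simp add: distribution_on_def)
  show "sets F = sets (restrict_space borel {0..vmax})"
    using assms unfolding distribution_on_def values_space_def by blast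
  from sets_eq_imp_space_eq[OF this] show "space F = {0..vmax}"
    by (simp add: space_restrict_space)
qed

lemma distribution_on_sets:
  assumes "distribution_on vmax F" "B \<in> sets borel"
  shows "{u \<in> space F. u \<in> B} \<in> sets F"
proof -
  have "{u \<in> space F. u \<in> B} = {0..vmax} \<inter> B"
    unfolding distribution_on_simps(2)[OF assms(1)] by blast
  then show ?thesis
    unfolding distribution_on_simps(3)[OF assms(1)] sets_restrict_space
    using assms(2) by (rule image_eqI)
qed

lemma price_revenue_eq:
  assumes "distribution_on vmax F"
  shows "price_revenue F p = p * measure F {u \<in> space F. p \<le> u}"
proof -
  interpret prob_space F by (rule distribution_on_simps(1)[OF assms])
  have m: "{u \<in> space F. u < p} \<in> sets F"
    using distribution_on_sets[OF assms, of "{..<p}"] by simp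
  have e: "{u \<in> space F. p \<le> u} = space F - {u \<in> space F. u < p}" by auto
  show ?thesis
    unfolding e price_revenue_def distr_fun_def prob_compl[OF m] ..
qed

lemma upper_sets:
  assumes "distribution_on vmax F"
  shows "{u \<in> space F. (p::real) \<le> u} \<in> sets F"
  using distribution_on_sets[OF assms, of "{p..}"] by simp

lemma price_revenue_bound:
  assumes "distribution_on vmax F" "p \<ge> 0"
  shows "price_revenue F p \<le> vmax" "price_revenue F p \<ge> 0"
    "price_revenue F p > 0 \<Longrightarrow> p \<le> vmax"
proof -
  interpret prob_space F by (rule distribution_on_simps(1)[OF assms(1)])
  have vm: "0 \<le> vmax"
    using not_empty distribution_on_simps(2)[OF assms(1)] by auto
  have z: "price_revenue F p = 0" if "p > vmax"
  proof -
    have "{u \<in> space F. p \<le> u} = {}"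
      using that distribution_on_simps(2)[OF assms(1)] by auto
    then show ?thesis using price_revenue_eq[OF assms(1)] by (metis measure_empty mult_zero_right)
  qed
  show "price_revenue F p \<ge> 0"
    using price_revenue_eq[OF assms(1)] assms(2) by simp
  show "price_revenue F p > 0 \<Longrightarrow> p \<le> vmax" using z by fastforce
  show "price_revenue F p \<le> vmax"
  proof (cases "p > vmax")
    case False
    have "p * measure F {u \<in> space F. p \<le> u} \<le> p * 1"
      using assms(2) by (intro mult_left_mono) auto
    then show ?thesis using False price_revenue_eq[OF assms(1), of p] by simp
  qed (use z vm in simp)
qed

lemma price_revenue_le_OPT:
  assumes "distribution_on vmax F" "p \<ge> 0"
  shows "price_revenue F p \<le> OPT F"
  unfolding OPT_def
  using assms price_revenue_bound(1)[OF assms(1)]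
  by (intro cSUP_upper) (auto intro!: bdd_aboveI[of _ vmax])

lemma OPT_attained:
  assumes D: "distribution_on vmax F"
  shows "\<exists>p\<ge>0. price_revenue F p = OPT F"
proof (cases "OPT F \<le> 0")
  case True
  have "price_revenue F 0 = 0" by (simp add: price_revenue_def)
  then show ?thesis using price_revenue_le_OPT[OF D, of 0] True by (intro exI[of _ 0]) auto
next
  case False
  interpret prob_space F by (rule distribution_on_simps(1)[OF D])
  let ?G = "\<lambda>p. measure F {u \<in> space F. p \<le> u}"
  have "\<exists>p\<ge>0. price_revenue F p > OPT F - OPT F / real (n + 2)" for n
  proof -
    have "OPT F - OPT F / real (n + 2) < OPT F" using False by (simp add: field_simps)
    then obtain p where "p \<in> {0::real..}" "OPT F - OPT F / real (n + 2) < price_revenue F p"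
      unfolding OPT_def
      using price_revenue_bound(1)[OF D]
      by (subst (asm) less_cSUP_iff) (auto intro!: bdd_aboveI[of _ vmax])
    then show ?thesis by auto
  qed
  then obtain q where q0: "\<And>n. q n \<ge> 0"
    and q: "\<And>n. price_revenue F (q n) > OPT F - OPT F / real (n + 2)" by metis
  have qv: "q n \<le> vmax" for n
  proof -
    have "OPT F - OPT F / real (n + 2) \<ge> 0" using False by (simp add: field_simps)
    then show ?thesis using q[of n] price_revenue_bound(3)[OF D q0[of n]] by simp
  qed
  have "(\<lambda>n. OPT F - OPT F / real (n + 2)) \<longlonglongrightarrow> OPT F" by real_asymp
  then have lim: "(\<lambda>n. price_revenue F (q n)) \<longlonglongrightarrow> OPT F"
    by (rule tendsto_sandwich[rotated 2, OF _ tendsto_const])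
       (intro always_eventually allI less_imp_le[OF q] price_revenue_le_OPT[OF D q0])+
  obtain r :: "nat \<Rightarrow> nat" where r: "strict_mono r" and m: "monoseq (\<lambda>n. q (r n))"
    using seq_monosub[of q] by blast
  have "Bseq (\<lambda>n. q (r n))"
    by (rule BseqI'[of _ vmax]) (use q0 qv in auto)
  then obtain l where l: "(\<lambda>n. q (r n)) \<longlonglongrightarrow> l"
    using Bseq_monoseq_convergent[OF _ m] by (auto simp: convergent_def)
  have l0: "l \<ge> 0" using l q0 by (intro LIMSEQ_le_const[OF l]) auto
  have lim': "(\<lambda>n. q (r n) * ?G (q (r n))) \<longlonglongrightarrow> OPT F"
    using LIMSEQ_subseq_LIMSEQ[OF lim r] by (simp add: o_def price_revenue_eq[OF D])
  have "OPT F \<le> l * ?G l"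
  proof (cases "incseq (\<lambda>n. q (r n))")
    case True
    have ql: "q (r n) \<le> l" for n using incseq_le[OF True l] .
    have "(\<lambda>n. ?G (q (r n))) \<longlonglongrightarrow> measure F (\<Inter>n. {u \<in> space F. q (r n) \<le> u})"
      using True by (intro finite_Lim_measure_decseq)
        (auto simp: decseq_def incseq_def intro: upper_sets[OF D] order_trans)
    also have "(\<Inter>n. {u \<in> space F. q (r n) \<le> u}) = {u \<in> space F. l \<le> u}"
      using ql by (auto intro: order_trans LIMSEQ_le_const2[OF l])
    finally have "(\<lambda>n. q (r n) * ?G (q (r n))) \<longlonglongrightarrow> l * ?G l"
      by (intro tendsto_mult l)
    then show ?thesis using LIMSEQ_unique[OF lim'] by simp
  next
    case False
    then have d: "decseq (\<lambda>n. q (r n))" using m by (simp add: monoseq_iff)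
    have "?G (q (r n)) \<le> ?G l" for n
      using decseq_ge[OF d l, of n] by (intro finite_measure_mono upper_sets[OF D]) auto
    then have "q (r n) * ?G (q (r n)) \<le> q (r n) * ?G l" for n
      by (intro mult_left_mono q0)
    moreover have "(\<lambda>n. q (r n) * ?G l) \<longlonglongrightarrow> l * ?G l" by (intro tendsto_intros l)
    ultimately show ?thesis using LIMSEQ_le[OF lim'] by blast
  qed
  then show ?thesis
    using price_revenue_le_OPT[OF D l0] price_revenue_eq[OF D, of l] l0
    by (intro exI[of _ l]) auto
qed

end

theory Submission imports Defs
begin

text \<open>In the hallucinatory state the good is offered at the price \<open>max s r\<close>, where \<open>s\<close> is the
  signal and \<open>r\<close> an optimal posted price; in the accurate state it is sold for \<open>v\<close>. Posted prices
  are truthful, and lying about the accurate state would mean paying at least \<open>s = v\<close>. For values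
  \<open>s, v\<close> with \<open>v \<ge> r\<close>, at least one of the sales with (signal, value) \<open>(s, v)\<close> and \<open>(v, s)\<close>
  takes place, at a price of at least \<open>r\<close>; as \<open>s\<close> and \<open>v\<close> are exchangeable, twice the expected
  payment is at least \<open>r \<cdot> P[v \<ge> r] = OPT\<close>.\<close>

text \<open>Ties count as sales. \<open>sale_payment_swap\<close> needs this when
  \<open>s = v\<close> or when the larger of the two equals \<open>r\<close>; atoms of
  \<open>F\<close> can give such pairs positive probability.\<close>

definition sale :: "real \<Rightarrow> real \<Rightarrow> real \<Rightarrow> real" where
  "sale r s v = of_bool (max s r \<le> v)"

definition sale_payment :: "real \<Rightarrow> real \<Rightarrow> real \<Rightarrow> real" where
  "sale_payment r s v = max s r * sale r s v"

definition reserve_alloc :: "real \<Rightarrow> rule" where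
  "reserve_alloc r s v \<theta> = (case \<theta> of Accurate \<Rightarrow> 1 | Hallucinatory \<Rightarrow> sale r s v)"

definition reserve_payment :: "real \<Rightarrow> rule" where
  "reserve_payment r s v \<theta> = (case \<theta> of Accurate \<Rightarrow> v | Hallucinatory \<Rightarrow> sale_payment r s v)"

text \<open>The price \<open>max s r\<close> ignores the report, which only decides whether to buy
  at it, so truth is optimal for each signal and not only in expectation.\<close>

lemma sale_optimal:
  "v * sale r s v' - sale_payment r s v' \<le> v * sale r s v - sale_payment r s v"
  by (auto simp: sale_def sale_payment_def)

lemma sale_utility_nonneg: "0 \<le> v * sale r s v - sale_payment r s v"
  by (auto simp: sale_def sale_payment_def)

text \<open>A sale happens only at a price of at most \<open>v\<close>; this bound is uniform in the
  signal and gives integrability.\<close>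

lemma sale_payment_bounds:
  assumes "0 \<le> r" "0 \<le> v"
  shows "0 \<le> sale_payment r s v" "sale_payment r s v \<le> v"
  using assms by (auto simp: sale_def sale_payment_def)

text \<open>If \<open>v\<close> is at least \<open>r\<close>, the order with the larger number as
  value and the smaller as signal gives a sale, since the larger number is at least \<open>r\<close>
  too.\<close>

lemma sale_payment_swap:
  assumes "0 \<le> r" "0 \<le> s" "0 \<le> v"
  shows "r * indicator {r..} v \<le> sale_payment r s v + sale_payment r v s"
  using assms by (auto simp: sale_def sale_payment_def indicator_def)

lemma borel_measurable_sale [measurable]:
  assumes [measurable]: "f \<in> borel_measurable M" "g \<in> borel_measurable M"
  shows "(\<lambda>z. sale r (f z) (g z)) \<in> borel_measurable M"
    and "(\<lambda>z. sale_payment r (f z) (g z)) \<in> borel_measurable M"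
  unfolding sale_def sale_payment_def by measurable

lemma borel_measurable_values_ident:
  "(\<lambda>v. v) \<in> borel_measurable (values_space vmax)"
  unfolding values_space_def by (rule measurable_restrict_space1) simp

lemma reserve_mechanism:
  assumes D: "distribution_on vmax F" and r: "0 \<le> r"
  shows "mechanism vmax F (reserve_alloc r) (reserve_payment r)"
proof -
  interpret prob_space F by (rule distribution_on_simps(1)[OF D])
  interpret P: pair_prob_space F F ..
  note sp = distribution_on_simps(2)[OF D]
  note vs[measurable] = borel_measurable_values_ident[of vmax]
  have sF: "sets F = sets (values_space vmax)"
    using D by (simp add: distribution_on_def)
  have id[measurable]: "(\<lambda>v. v) \<in> borel_measurable F"
    using vs measurable_cong_sets[OF sF refl] by blast
  have int_sale: "integrable F (\<lambda>s. sale r s v)" for v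
    by (intro integrable_const_bound[where B = 1]) (auto simp: sale_def)
  have int_pay: "integrable F (\<lambda>s. sale_payment r s v)" if "v \<in> {0..vmax}" for v
    using that sale_payment_bounds[OF r, of v]
    by (intro integrable_const_bound[where B = v]) auto
  have int_util: "integrable F (\<lambda>s. u * sale r s v - sale_payment r s v)"
    if "v \<in> {0..vmax}" for u v
    using int_sale int_pay[OF that] by auto
  have "\<bar>sale_payment r s v\<bar> \<le> vmax" if "v \<in> {0..vmax}" for s v
    using that sale_payment_bounds[OF r, of v s] by auto
  then have int_pair: "integrable (F \<Otimes>\<^sub>M F) (\<lambda>(s, v). sale_payment r s v)"
    by (intro P.integrable_const_bound[where B = vmax])
       (auto intro!: AE_I2 simp: space_pair_measure sp)
  have "incentive_compatible vmax F (reserve_alloc r) (reserve_payment r)"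
    unfolding incentive_compatible_def reserve_alloc_def reserve_payment_def
    by (auto intro!: integral_mono int_util sale_optimal)
       \<comment> \<open>In the accurate state the signal is \<open>v\<close>: a false report leads
         to no sale or to one at \<open>max v r\<close>, so its utility is at most 0, which is what
         truth yields.\<close>
       (auto simp: sale_def sale_payment_def)
  moreover have "individually_rational vmax F (reserve_alloc r) (reserve_payment r)"
    unfolding individually_rational_def reserve_alloc_def reserve_payment_def
    \<comment> \<open>The deleted simp rule would turn the difference into a comparison that
      \<open>sale_utility_nonneg\<close> no longer matches.\<close>
    by (auto intro!: integral_nonneg_AE AE_I2 sale_utility_nonneg simp del: diff_ge_0_iff_ge)
  moreover have "(\<lambda>(s, v). reserve_alloc r s v \<theta>)
      \<in> borel_measurable (values_space vmax \<Otimes>\<^sub>M values_space vmax)" for \<theta>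
    by (cases \<theta>) (simp_all add: reserve_alloc_def)
  moreover have "(\<lambda>(s, v). reserve_payment r s v \<theta>)
      \<in> borel_measurable (values_space vmax \<Otimes>\<^sub>M values_space vmax)" for \<theta>
    by (cases \<theta>) (simp_all add: reserve_payment_def)
  moreover have "reserve_alloc r s v \<theta> \<in> {0..1}" for s v \<theta>
    by (cases \<theta>) (auto simp: reserve_alloc_def sale_def)
  ultimately show ?thesis
    using int_pay int_pair unfolding mechanism_def by (simp add: reserve_payment_def)
qed

lemma reserve_robust:
  assumes D: "distribution_on vmax F" and r: "0 \<le> r" and opt: "price_revenue F r = OPT F"
  shows "robust F (1 / 2) (reserve_payment r)"
proof -
  interpret prob_space F by (rule distribution_on_simps(1)[OF D])
  interpret P: pair_prob_space F F ..
  let ?pay = "\<lambda>(s, v). sale_payment r s v"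
  have int: "integrable (F \<Otimes>\<^sub>M F) ?pay"
    using reserve_mechanism[OF D r] by (simp add: mechanism_def reserve_payment_def)
  have int': "integrable (F \<Otimes>\<^sub>M F) (\<lambda>(s, v). sale_payment r v s)"
    using P.integrable_product_swap[OF int] by simp
  have swap: "(\<integral>(s, v). sale_payment r v s \<partial>(F \<Otimes>\<^sub>M F)) = (\<integral>z. ?pay z \<partial>(F \<Otimes>\<^sub>M F))"
    using P.integral_product_swap[OF borel_measurable_integrable[OF int]] by simp
  let ?U = "{u \<in> space F. r \<le> u}"
  note U[measurable] = upper_sets[OF D, of r]
  have "OPT F = r * measure F ?U"
    using opt price_revenue_eq[OF D] by simp
  \<comment> \<open>Lifting the event to pairs allows a comparison pointwise in
    \<open>(s, v)\<close>.\<close>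
  also have "\<dots> = r * measure (F \<Otimes>\<^sub>M F) (space F \<times> ?U)"
    using U by (simp add: measure_def emeasure_pair_measure_Times emeasure_space_1)
  also have "\<dots> = (\<integral>z. r * indicator (space F \<times> ?U) z \<partial>(F \<Otimes>\<^sub>M F))"
    using U by simp
  also have "\<dots> \<le> (\<integral>z. ?pay z + (\<lambda>(s, v). sale_payment r v s) z \<partial>(F \<Otimes>\<^sub>M F))"
  proof (rule integral_mono)
    show "integrable (F \<Otimes>\<^sub>M F) (\<lambda>z. r * indicator (space F \<times> ?U) z)"
      using U by (intro integrable_mult_right integrable_real_indicator) (auto simp: less_top[symmetric])
    fix z assume "z \<in> space (F \<Otimes>\<^sub>M F)"
    then obtain s v where "z = (s, v)" "0 \<le> s" "0 \<le> v" "s \<in> space F" "v \<in> space F"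
      using distribution_on_simps(2)[OF D] by (auto simp: space_pair_measure)
    then show "r * indicator (space F \<times> ?U) z \<le> ?pay z + (\<lambda>(s, v). sale_payment r v s) z"
      using sale_payment_swap[OF r, of s v] by (simp add: indicator_def)
  qed (intro Bochner_Integration.integrable_add int int')
  also have "\<dots> = 2 * (\<integral>z. ?pay z \<partial>(F \<Otimes>\<^sub>M F))"
    unfolding Bochner_Integration.integral_add[OF int int'] swap by simp
  finally show ?thesis
    by (simp add: robust_def reserve_payment_def)
qed

theorem theorem1p2:
  fixes vmax :: real and F :: "real measure"
  assumes "0 < vmax"
    and "distribution_on vmax F"
  shows "\<exists>x p. mechanism vmax F x p \<and> consistent vmax 1 p \<and> robust F (1 / 2) p"
proof -
  \<comment> \<open>An attained maximum gives the factor 1/2 exactly; a nearly optimal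
    \<open>r\<close> would lose a little in this argument.\<close>
  obtain r where r: "0 \<le> r" "price_revenue F r = OPT F"
    using OPT_attained[OF assms(2)] by blast
  have "consistent vmax 1 (reserve_payment r)"
    by (simp add: consistent_def reserve_payment_def)
  then show ?thesis
    using reserve_mechanism[OF assms(2) r(1)] reserve_robust[OF assms(2) r] by blast
qed

end
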